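(* Let $n\ge2$, $1\le k\le n-1$, let $T\subset\mathbb R^n$ be an $n$-simplex, $0\le\ell\le n$, and $f$ an $\ell$-dimensional sub-simplex of $T$. Given any $t$-$n$ basis of $f$, one has the direct sum decomposition $$\mathbb X=\mathscr T^f(\mathbb X)\oplus\mathscr N^f(\mathbb X),$$ and $$\dim\mathscr T^f(\mathbb X)=\ell\binom nk+\binom{n-\ell}{n-k+1}-\binom n{k-1},\qquad \dim\mathscr N^f(\mathbb X)=(n-\ell)\binom nk-\binom{n-\ell}{n-k+1}.$$
   Context: Forms. $\mathrm{Alt}^j$ is the space of alternating $j$-linear forms on $\mathbb R^n$; $\mathrm{Alt}^{k,n-1}=\mathrm{Alt}^k\otimes\mathrm{Alt}^{n-1}$. The map $s^{k,n-1}:\mathrm{Alt}^{k,n-1}\to\mathrm{Alt}^{k-1}\otimes\mathrm{Alt}^n$ is $$s^{k,n-1}\omega(w_1,\dots,w_{k-1})(v_1,\dots,v_n)=\sum_{i=1}^n(-1)^{i-1}\omega(v_i,w_1,\dots,w_{k-1})(v_1,\dots,\widehat{v_i},\dots,v_n),$$ and $\mathbb X:=\ker(s^{k,n-1})$. Index notation. $\Sigma(1:j,1:n)$ is the set of increasing sequences of length $j$ in $\{1,\dots,n\}$, identified with subsets; $\sigma^c$ is the complement in $\{1,\dots,n\}$; for $i\notin\tau$, $i+\tau=\tau\cup\{i\}$, and $\epsilon(i,\tau)$ is the sign of the permutation sorting $(i,\tau(1),\dots,\tau(k-1))$ increasingly. For a basis $\{\mathrm dy_i\}_{i=1}^n$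 of $\mathrm{Alt}^1$: $\mathrm dy_\sigma=\mathrm dy_{\sigma(1)}\wedge\cdots\wedge \mathrm dy_{\sigma(k)}$ and $*\mathrm dy_i=(-1)^{i-1}\mathrm dy_1\wedge\cdots\wedge\widehat{\mathrm dy_i}\wedge\cdots\wedge \mathrm dy_n$. Constraint sequences. For $\tau\in\Sigma(1:k-1,1:n)$ write $\tau^c=\{i_1<\dots<i_{n-k+1}\}$. The constraint sequence of $\tau$ is $\{(i_m+\tau,i_m)\}_{m=1}^{n-k+1}$; its first element $(i_1+\tau,i_1)$ is its pair index. An index $(\sigma,i)$, $\sigma\in\Sigma(1:k,1:n)$, $1\le i\le n$, is free if it is not the pair index of any constraint sequence (in particular every $(\sigma,i)$ with $i\in\sigma^c$ is free). Oblique projection. The linear map $\pi_{\mathbb X}:\mathrm{Alt}^{k,n-1}\to\mathbb X$ is defined on basis elements by $\pi_{\mathbb X}(\mathrm dy_\sigma\otimes *\mathrm dy_i)=\mathrm dy_\sigma\otimes *\mathrm dy_i$ if $i\in\sigma^c$, and, along the constraint sequence of $\tau$, with $\sigma_{i_m}=i_m+\tau$, by $\pi_{\mathbb X}(\mathrm dy_{\sigma_{i_m}}\otimes*\mathrm dy_{i_m})=\mathrm dy_{\sigma_{i_m}}\otimes*\mathrm dy_{i_m}-\epsilon(i_m,\tau)\epsilon(i_1,\tau)\,\mathrm dy_{\sigma_{i_1}}\otimes*\mathrm dy_{i_1}$, $m=1,\dots,n-k+1$. $t$-$n$ basis. A $t$-$n$ basis of $f$ consists of $\ell$ linearly independent unit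 vectors $\boldsymbol t^f_1,\dots,\boldsymbol t^f_\ell$ tangential to $f$ followed by $n-\ell$ linearly independent unit vectors $\boldsymbol n_1^f,\dots,\boldsymbol n^f_{n-\ell}$ orthogonal to the tangent plane of $f$. The corresponding basis of $\mathrm{Alt}^1$ is $\mathrm dy_i^f(w)=\boldsymbol t_i^f\cdot w$ for $1\le i\le\ell$ (written $i\in\mathscr T^f$) and $\mathrm dy_i^f(w)=\boldsymbol n_{i-\ell}^f\cdot w$ for $\ell+1\le i\le n$ (written $i\in\mathscr N^f$). Using this basis in $\pi_{\mathbb X}$, define $$\mathscr T^f(\mathbb X)=\mathrm{span}\{\pi_{\mathbb X}(\mathrm dy^f_\sigma\otimes*\mathrm dy_i^f):(\sigma,i)\text{ free},\,i\in\mathscr T^f\},\quad \mathscr N^f(\mathbb X)=\mathrm{span}\{\pi_{\mathbb X}(\mathrm dy^f_\sigma\otimes*\mathrm dy_i^f):(\sigma,i)\text{ free},\,i\in\mathscr N^f\}.$$ *)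

theory Defs
  imports "HOL-Analysis.Analysis" "HOL-Library.Function_Algebras"
begin

text \<open>Real-valued functions form a real vector space under the pointwise operations, so that
  \<open>span\<close>, \<open>dim\<close>, \<open>linear\<close> and \<open>construct\<close> apply to spaces of forms.\<close>

instantiation "fun" :: (type, real_vector) real_vector
begin

definition scaleR_fun :: "real \<Rightarrow> ('a \<Rightarrow> 'b) \<Rightarrow> 'a \<Rightarrow> 'b" where
  "scaleR_fun c f = (\<lambda>x. c *\<^sub>R f x)"

instance
  by standard (auto simp: scaleR_fun_def fun_eq_iff scaleR_add_right scaleR_add_left)

end

section \<open>Alternating forms\<close>

text \<open>A \<open>j\<close>-linear form is a function of the list of its \<open>j\<close> arguments, set to \<open>0\<close> on lists of
  any other length.\<close>

definition Alt :: "nat \<Rightarrow> ('a::euclidean_space list \<Rightarrow> real) set" where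
  "Alt j = {\<alpha>.
     (\<forall>vs. length vs \<noteq> j \<longrightarrow> \<alpha> vs = 0) \<and>
     (\<forall>vs i. length vs = j \<longrightarrow> i < j \<longrightarrow> linear (\<lambda>x. \<alpha> (vs[i := x]))) \<and>
     (\<forall>vs i i'. length vs = j \<longrightarrow> i < i' \<longrightarrow> i' < j \<longrightarrow> vs ! i = vs ! i' \<longrightarrow> \<alpha> vs = 0)}"

text \<open>\<open>Alt\<^sup>k \<otimes> Alt\<^sup>m\<close> is realised as the space of functions \<open>\<omega>(w\<^sub>1,\<dots>,w\<^sub>k)(v\<^sub>1,\<dots>,v\<^sub>m)\<close> spanned by
  the products of a \<open>k\<close>-form in \<open>w\<close> and an \<open>m\<close>-form in \<open>v\<close>.\<close>

definition tensor :: "('a list \<Rightarrow> real) \<Rightarrow> ('a list \<Rightarrow> real) \<Rightarrow> 'a list \<Rightarrow> 'a list \<Rightarrow> real" where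
  "tensor \<alpha> \<beta> = (\<lambda>ws vs. \<alpha> ws * \<beta> vs)"

definition Alt2 :: "nat \<Rightarrow> nat \<Rightarrow> ('a::euclidean_space list \<Rightarrow> 'a list \<Rightarrow> real) set" where
  "Alt2 k m = span {tensor \<alpha> \<beta> |\<alpha> \<beta>. \<alpha> \<in> Alt k \<and> \<beta> \<in> Alt m}"

text \<open>Positions in \<open>vs\<close> are counted from \<open>0\<close>, which turns \<open>(-1)\<^sup>i\<^sup>-\<^sup>1\<close> into \<open>(-1)\<^sup>i\<close>. No restriction
  on lengths is needed: for \<open>\<omega> \<in> Alt2 k (n - 1)\<close> all summands vanish
  unless \<open>ws\<close> has length \<open>k - 1\<close> and \<open>vs\<close> has length \<open>n\<close>.\<close>

definition s_map :: "('a list \<Rightarrow> 'a list \<Rightarrow> real) \<Rightarrow> 'a list \<Rightarrow> 'a list \<Rightarrow> real" where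
  "s_map \<omega> = (\<lambda>ws vs. \<Sum>i<length vs.
     (-1) ^ i * \<omega> (vs ! i # ws) (take i vs @ drop (Suc i) vs))"

definition XX :: "nat \<Rightarrow> nat \<Rightarrow> ('a::euclidean_space list \<Rightarrow> 'a list \<Rightarrow> real) set" where
  "XX n k = {\<omega> \<in> Alt2 k (n - 1). s_map \<omega> = 0}"

text \<open>Wedge product of a list of 1-forms, in the determinant convention.\<close>

definition wedge :: "('a \<Rightarrow> real) list \<Rightarrow> 'a list \<Rightarrow> real" where
  "wedge \<phi>s vs = (if length vs = length \<phi>s
     then \<Sum>p | p permutes {..<length \<phi>s}.
            of_int (sign p) * (\<Prod>j<length \<phi>s. (\<phi>s ! j) (vs ! p j))
     else 0)"

section \<open>Indices and constraint sequences\<close>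

definition Sig :: "nat \<Rightarrow> nat \<Rightarrow> nat set set" where
  "Sig j n = {\<sigma>. \<sigma> \<subseteq> {1..n} \<and> card \<sigma> = j}"

definition eps :: "nat \<Rightarrow> nat set \<Rightarrow> int" where
  "eps i \<tau> = (let xs = i # sorted_list_of_set \<tau> in
     sign (THE p. p permutes {..<length xs} \<and> sorted (permute_list p xs)))"

definition constraint_seq :: "nat \<Rightarrow> nat set \<Rightarrow> (nat set \<times> nat) list" where
  "constraint_seq n \<tau> = map (\<lambda>i. (insert i \<tau>, i)) (sorted_list_of_set ({1..n} - \<tau>))"

definition pair_index :: "nat \<Rightarrow> nat set \<Rightarrow> nat set \<times> nat" where
  "pair_index n \<tau> = hd (constraint_seq n \<tau>)"

definition all_indices :: "nat \<Rightarrow> nat \<Rightarrow> (nat set \<times> nat) set" where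
  "all_indices n k = Sig k n \<times> {1..n}"

definition free_indices :: "nat \<Rightarrow> nat \<Rightarrow> (nat set \<times> nat) set" where
  "free_indices n k = all_indices n k - pair_index n ` Sig (k - 1) n"

section \<open>The oblique projection\<close>

text \<open>Below, \<open>dy 1, \<dots>, dy n\<close> is a basis of the space of 1-forms.\<close>

definition dy_wedge :: "(nat \<Rightarrow> 'a \<Rightarrow> real) \<Rightarrow> nat set \<Rightarrow> 'a list \<Rightarrow> real" where
  "dy_wedge dy \<sigma> = wedge (map dy (sorted_list_of_set \<sigma>))"

definition dy_star :: "nat \<Rightarrow> (nat \<Rightarrow> 'a \<Rightarrow> real) \<Rightarrow> nat \<Rightarrow> 'a list \<Rightarrow> real" where
  "dy_star n dy i = (-1) ^ (i - 1) *\<^sub>R dy_wedge dy ({1..n} - {i})"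

definition basis_elt ::
  "nat \<Rightarrow> (nat \<Rightarrow> 'a \<Rightarrow> real) \<Rightarrow> nat set \<times> nat \<Rightarrow> 'a list \<Rightarrow> 'a list \<Rightarrow> real" where
  "basis_elt n dy = (\<lambda>(\<sigma>, i). tensor (dy_wedge dy \<sigma>) (dy_star n dy i))"

text \<open>An index \<open>(\<sigma>, i)\<close> with \<open>i \<in> \<sigma>\<close> lies in exactly one constraint sequence, that of
  \<open>\<tau> = \<sigma> - {i}\<close>.\<close>

definition proj_value ::
  "nat \<Rightarrow> (nat \<Rightarrow> 'a \<Rightarrow> real) \<Rightarrow> nat set \<times> nat \<Rightarrow> 'a list \<Rightarrow> 'a list \<Rightarrow> real" where
  "proj_value n dy = (\<lambda>(\<sigma>, i).
     if i \<in> \<sigma> then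
       let \<tau> = \<sigma> - {i}; (\<sigma>\<^sub>1, i\<^sub>1) = pair_index n \<tau>
       in basis_elt n dy (\<sigma>, i) - real_of_int (eps i \<tau> * eps i\<^sub>1 \<tau>) *\<^sub>R basis_elt n dy (\<sigma>\<^sub>1, i\<^sub>1)
     else basis_elt n dy (\<sigma>, i))"

text \<open>The linear map prescribed on the basis elements by \<open>proj_value\<close>. Its values outside
  \<open>Alt2 k (n - 1)\<close> are irrelevant.\<close>

definition proj_XX ::
  "nat \<Rightarrow> nat \<Rightarrow> (nat \<Rightarrow> 'a \<Rightarrow> real) \<Rightarrow> ('a list \<Rightarrow> 'a list \<Rightarrow> real) \<Rightarrow> ('a list \<Rightarrow> 'a list \<Rightarrow> real)" where
  "proj_XX n k dy = construct (basis_elt n dy ` all_indices n k)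
     (\<lambda>\<omega>. proj_value n dy (inv_into (all_indices n k) (basis_elt n dy) \<omega>))"

lemma proj_XX_basis_elt:
  assumes "inj_on (basis_elt n dy) (all_indices n k)"
    and "independent (basis_elt n dy ` all_indices n k)"
    and "\<sigma>i \<in> all_indices n k"
  shows "proj_XX n k dy (basis_elt n dy \<sigma>i) = proj_value n dy \<sigma>i"
  using assms by (simp add: proj_XX_def real_vector.construct_basis)

section \<open>\<open>t\<close>-\<open>n\<close> bases\<close>

definition tangent_space :: "'a::euclidean_space set \<Rightarrow> 'a set" where
  "tangent_space f = span {x - y |x y. x \<in> f \<and> y \<in> f}"

text \<open>\<open>b 1, \<dots>, b l\<close> are the tangential vectors and \<open>b (l + 1), \<dots>, b n\<close> the normal ones.\<close>

definition tn_basis :: "nat \<Rightarrow> nat \<Rightarrow> 'a::euclidean_space set \<Rightarrow> (nat \<Rightarrow> 'a) \<Rightarrow> bool" where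
  "tn_basis n l f b \<longleftrightarrow>
     (\<forall>i\<in>{1..n}. norm (b i) = 1) \<and>
     (\<forall>i\<in>{1..l}. b i \<in> tangent_space f) \<and>
     inj_on b {1..l} \<and> independent (b ` {1..l}) \<and>
     (\<forall>i\<in>{l+1..n}. \<forall>t\<in>tangent_space f. orthogonal (b i) t) \<and>
     inj_on b {l+1..n} \<and> independent (b ` {l+1..n})"

definition dual_form :: "(nat \<Rightarrow> 'a::euclidean_space) \<Rightarrow> nat \<Rightarrow> 'a \<Rightarrow> real" where
  "dual_form b i = (\<lambda>w. b i \<bullet> w)"

definition T_XX ::
  "nat \<Rightarrow> nat \<Rightarrow> nat \<Rightarrow> (nat \<Rightarrow> 'a::euclidean_space) \<Rightarrow> ('a list \<Rightarrow> 'a list \<Rightarrow> real) set" where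
  "T_XX n k l b = span {proj_XX n k (dual_form b) (basis_elt n (dual_form b) (\<sigma>, i)) |\<sigma> i.
     (\<sigma>, i) \<in> free_indices n k \<and> i \<in> {1..l}}"

definition N_XX ::
  "nat \<Rightarrow> nat \<Rightarrow> nat \<Rightarrow> (nat \<Rightarrow> 'a::euclidean_space) \<Rightarrow> ('a list \<Rightarrow> 'a list \<Rightarrow> real) set" where
  "N_XX n k l b = span {proj_XX n k (dual_form b) (basis_elt n (dual_form b) (\<sigma>, i)) |\<sigma> i.
     (\<sigma>, i) \<in> free_indices n k \<and> i \<in> {l+1..n}}"

end

theory Submission
  imports Defs
begin

text \<open>Let \<open>e\<close> be the frame dual to the coframe \<open>dy\<close>. A form in \<open>Alt2 k (n - 1)\<close> is determined by its
  values on increasing tuples of frame vectors, which up to sign are its coordinates with respect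
  to the products \<open>dy\<^sub>\<sigma> \<otimes> *dy\<^sub>i\<close>; the same principle reduces \<open>s_map \<omega> = 0\<close> to one scalar equation
  for each \<open>\<tau>\<close>, a signed sum of the coordinates along the constraint sequence of \<open>\<tau>\<close>.
  The projections of free basis elements satisfy these equations, and their free coordinates form
  an identity matrix. Conversely, if the free coordinates of a form in the kernel vanish, each
  equation involves only the pair index of \<open>\<tau>\<close>, so the form is \<open>0\<close>. Hence the projections of the
  free basis elements form a basis of the kernel, and splitting the free indices by \<open>i \<le> l\<close> gives
  the direct sum. For the dimensions, the pair index of \<open>\<tau>\<close> is normal iff \<open>{1..l} \<subseteq> \<tau>\<close>, and
  passing to complements there are \<open>(n - l) choose (n - k + 1)\<close> such \<open>\<tau>\<close>.\<close>

section \<open>Alternating forms\<close>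

lemma Alt_length: "\<alpha> \<in> Alt j \<Longrightarrow> length vs \<noteq> j \<Longrightarrow> \<alpha> vs = 0"
  by (auto simp: Alt_def)

lemma Alt_update: "\<alpha> \<in> Alt j \<Longrightarrow> i < length vs \<Longrightarrow> linear (\<lambda>x. \<alpha> (vs[i := x]))"
proof (cases "length vs = j")
  case False
  assume "\<alpha> \<in> Alt j"
  then have "(\<lambda>x. \<alpha> (vs[i := x])) = (\<lambda>x. 0)"
    using False by (auto simp: Alt_length)
  then show ?thesis
    by (simp add: linear_zero)
qed (auto simp: Alt_def)

lemma Alt_linear:
  assumes "\<alpha> \<in> Alt j"
  shows "linear (\<lambda>x. \<alpha> (xs @ x # ys))"
  using Alt_update[OF assms, of "length xs" "xs @ undefined # ys"] by simp

lemma Alt_not_distinct: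
  assumes "\<alpha> \<in> Alt j" "\<not> distinct vs"
  shows "\<alpha> vs = 0"
proof (cases "length vs = j")
  case True
  from assms(2) obtain i i' where "i < length vs" "i' < length vs" "i \<noteq> i'" "vs ! i = vs ! i'"
    by (auto simp: distinct_conv_nth)
  then show ?thesis
    using assms(1) True unfolding Alt_def
    by (cases "i < i'") (auto, metis nat_neq_iff)
qed (use assms Alt_length in auto)

text \<open>Polarisation: the form vanishes when both slots hold \<open>x + y\<close>, and expanding
  leaves only the two mixed terms.\<close>

lemma Alt_swap:
  assumes "\<alpha> \<in> Alt j"
  shows "\<alpha> (xs @ x # y # zs) = - \<alpha> (xs @ y # x # zs)"
proof -
  have 1: "linear (\<lambda>u. \<alpha> (xs @ u # v # zs))" and 2: "linear (\<lambda>u. \<alpha> (xs @ v # u # zs))" for v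
    using Alt_linear[OF assms, of xs "v # zs"] Alt_linear[OF assms, of "xs @ [v]" zs] by simp_all
  have 0: "\<alpha> (xs @ u # u # zs) = 0" for u
    by (rule Alt_not_distinct[OF assms]) simp
  have "\<alpha> (xs @ x # y # zs) + \<alpha> (xs @ y # x # zs) = \<alpha> (xs @ (x + y) # (x + y) # zs)"
    by (simp only: linear_add[OF 1] linear_add[OF 2]) (simp add: 0)
  also have "\<dots> = 0"
    by (rule 0)
  finally show ?thesis
    by linarith
qed

lemma Alt_move:
  assumes "\<alpha> \<in> Alt j"
  shows "\<alpha> (xs @ x # ys @ zs) = (-1) ^ length ys * \<alpha> (xs @ ys @ x # zs)"
proof (induction ys arbitrary: xs)
  case (Cons y ys)
  show ?case
    using Cons.IH[of "xs @ [y]"] Alt_swap[OF assms, of xs x y "ys @ zs"] by simp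
qed simp

text \<open>Insertion sort consists of adjacent swaps, and each swap only changes the sign.
  Recording mere vanishing suffices for the uniqueness arguments and avoids tracking the sign of the
  sorting permutation.\<close>

lemma Alt_sort:
  assumes "\<alpha> \<in> Alt j"
  shows "\<alpha> (map e (sort is)) = 0 \<longleftrightarrow> \<alpha> (map e is) = 0"
proof -
  \<comment> \<open>The prefix \<open>xs\<close> is arbitrary because an entry passed by the
    insertion joins it.\<close>
  have ins: "\<alpha> (map e (xs @ insort i ys)) = 0 \<longleftrightarrow> \<alpha> (map e (xs @ i # ys)) = 0" for i xs ys
  proof (induction ys arbitrary: xs)
    case (Cons y ys)
    show ?case
      using Cons.IH[of "xs @ [y]"] Alt_swap[OF assms, of "map e xs" "e i" "e y" "map e ys"] by simp
  qed simp
  have "\<alpha> (map e (xs @ sort is)) = 0 \<longleftrightarrow> \<alpha> (map e (xs @ is)) = 0" for xs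
  proof (induction "is" arbitrary: xs)
    case (Cons i "is")
    show ?case
      using ins[of xs i "sort is"] Cons.IH[of "xs @ [i]"] by simp
  qed simp
  from this[of "[]"] show ?thesis by simp
qed

lemma subspace_Alt: "subspace (Alt j)"
proof (rule subspaceI)
  show "0 \<in> Alt j"
    by (auto simp: Alt_def linear_zero)
next
  fix \<alpha> \<beta> :: "'a list \<Rightarrow> real" assume "\<alpha> \<in> Alt j" "\<beta> \<in> Alt j"
  then show "\<alpha> + \<beta> \<in> Alt j"
    unfolding Alt_def by (auto intro!: linear_compose_add)
next
  fix c and \<alpha> :: "'a list \<Rightarrow> real" assume "\<alpha> \<in> Alt j"
  then show "c *\<^sub>R \<alpha> \<in> Alt j"
    unfolding Alt_def
    by (auto simp: scaleR_fun_def linear_compose_scale_right[where 'b=real, simplified])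
qed

lemma Alt_Cons: "\<alpha> \<in> Alt j \<Longrightarrow> (\<lambda>ws. \<alpha> (v # ws)) \<in> Alt (j - 1)"
proof -
  assume \<alpha>: "\<alpha> \<in> Alt j"
  show ?thesis
    unfolding Alt_def mem_Collect_eq
  proof (intro conjI allI impI)
    fix vs :: "'a list" assume "length vs \<noteq> j - 1"
    then show "\<alpha> (v # vs) = 0"
      by (intro Alt_length[OF \<alpha>]) auto
  next
    fix vs :: "'a list" and i assume "length vs = j - 1" "i < j - 1"
    then show "linear (\<lambda>x. \<alpha> (v # vs[i := x]))"
      using Alt_update[OF \<alpha>, of "Suc i" "v # vs"] by simp
  next
    fix vs :: "'a list" and i i' assume "length vs = j - 1" "i < i'" "i' < j - 1" "vs ! i = vs ! i'"
    then show "\<alpha> (v # vs) = 0"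
      by (intro Alt_not_distinct[OF \<alpha>])
        (simp, metis distinct_conv_nth less_trans nat_neq_iff)
  qed
qed

text \<open>Serves multilinearity of an antisymmetrised sum: in summand \<open>i\<close>, a change
  at position \<open>p\<close> either hits the extracted vector or lands in the remaining list,
  shifted down by one when \<open>p > i\<close>.\<close>

lemma take_drop_list_update:
  "take i (vs[p := x]) @ drop (Suc i) (vs[p := x]) =
    (if p = i then take i vs @ drop (Suc i) vs
     else (take i vs @ drop (Suc i) vs)[(if p < i then p else p - 1) := x])"
  if "i < length vs"
proof -
  have "p - Suc i = p - 1 - i"
    by simp
  then show ?thesis
    using that by (auto simp: list_update_append take_update_swap drop_update_swap list_update_beyond)
qed

text \<open>This is the shape of \<open>s_map\<close> in its second group of arguments. If entries
  \<open>p < q\<close> agree, deleting any third entry leaves a repetition, so only summands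
  \<open>p\<close> and \<open>q\<close> survive. Moving the common vector past the
  \<open>q - p - 1\<close> entries between them shows that these two have opposite signs.\<close>

lemma Alt_antisymmetrize:
  assumes F: "\<And>v. F v \<in> Alt m" and lin: "\<And>us. linear (\<lambda>v. F v us)"
  shows "(\<lambda>vs. \<Sum>i<length vs. (-1) ^ i * F (vs ! i) (take i vs @ drop (Suc i) vs)) \<in> Alt (Suc m)"
    (is "(\<lambda>vs. \<Sum>i<length vs. ?t vs i) \<in> _")
  unfolding Alt_def mem_Collect_eq
proof (intro conjI allI impI)
  fix vs :: "'a list" assume "length vs \<noteq> Suc m"
  then show "(\<Sum>i<length vs. ?t vs i) = 0"
    by (intro sum.neutral) (auto intro!: Alt_length[OF F])
next
  fix vs :: "'a list" and p assume vs: "length vs = Suc m" "p < Suc m"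
  have "linear (\<lambda>x. ?t (vs[p := x]) i)" if "i < Suc m" for i
  proof (cases "p = i")
    case True
    then show ?thesis
      using vs that linear_compose_scale_right[OF lin, of "(-1) ^ i"]
      by (simp add: take_drop_list_update)
  next
    case False
    let ?q = "if p < i then p else p - 1"
    have "?q < length (take i vs @ drop (Suc i) vs)"
      using vs that False by auto
    from Alt_update[OF F this, THEN linear_compose_scale_right, of "(-1) ^ i" "vs ! i"]
    show ?thesis
      using vs that False by (simp add: take_drop_list_update)
  qed
  then show "linear (\<lambda>x. \<Sum>i<length (vs[p := x]). ?t (vs[p := x]) i)"
    using vs by (auto intro!: linear_compose_sum simp del: sum.lessThan_Suc)
next
  fix vs :: "'a list" and p q
  assume vs: "length vs = Suc m" "p < q" "q < Suc m" "vs ! p = vs ! q"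
  define x A M B where "x = vs ! p" and "A = take p vs" and "M = take (q - Suc p) (drop (Suc p) vs)"
    and "B = drop (Suc q) vs"
  have "vs = A @ x # drop (Suc p) vs"
    unfolding A_def x_def using vs id_take_nth_drop[of p vs] by simp
  also have "drop (Suc p) vs = M @ x # B"
    unfolding M_def B_def using vs id_take_nth_drop[of "q - Suc p" "drop (Suc p) vs"]
    by (simp add: x_def)
  finally have eq: "vs = A @ x # M @ x # B" .
  have len: "length A = p" "length M = q - Suc p"
    unfolding A_def M_def using vs by auto
  have t: "?t (xs @ x # ys) (length xs) = (-1) ^ length xs * F x (xs @ ys)" for xs ys
    by simp
  have "(\<Sum>i<length vs. ?t vs i) = (\<Sum>i\<in>{p, q}. ?t vs i)"
  proof (rule sum.mono_neutral_right)
    show "\<forall>i\<in>{..<length vs} - {p, q}. ?t vs i = 0"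
    proof
      fix i assume i: "i \<in> {..<length vs} - {p, q}"
      \<comment> \<open>Positions of the two equal entries once entry \<open>i\<close> is
        deleted.\<close>
      define p' q' where "p' = (if p < i then p else p - 1)" and "q' = (if q < i then q else q - 1)"
      have "(take i vs @ drop (Suc i) vs) ! p' = vs ! p" "(take i vs @ drop (Suc i) vs) ! q' = vs ! q"
        "p' \<noteq> q'" "p' < m" "q' < m"
        using i vs by (auto simp: nth_append p'_def q'_def)
      moreover have "length (take i vs @ drop (Suc i) vs) = m"
        using i vs by auto
      ultimately have "\<not> distinct (take i vs @ drop (Suc i) vs)"
        using vs(4) unfolding distinct_conv_nth by metis
      then show "?t vs i = 0"
        using Alt_not_distinct[OF F] by simp
    qed
  qed (use vs in auto)
  also have "\<dots> = ?t vs p + ?t vs q"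
    using vs by simp
  also have "?t vs p = (-1) ^ p * F x (A @ M @ x # B)"
    using t[of A "M @ x # B"] eq len by simp
  also have "?t vs q = (-1) ^ q * F x (A @ x # M @ B)"
    using t[of "A @ x # M" B] eq len vs by simp
  also have "F x (A @ x # M @ B) = (-1) ^ (q - Suc p) * F x (A @ M @ x # B)"
    using Alt_move[OF F, of x A x M B] len by simp
  also have "(-1) ^ q * ((-1) ^ (q - Suc p) * F x (A @ M @ x # B)) = - ((-1) ^ p * F x (A @ M @ x # B))"
  proof -
    obtain d where "q = Suc (p + d)"
      using vs less_imp_Suc_add by blast
    then show ?thesis
      by (simp add: power_add flip: mult.assoc power_mult_distrib)
  qed
  finally show "(\<Sum>i<length vs. ?t vs i) = 0"
    by simp
qed

text \<open>In each summand of the determinant, argument \<open>i\<close> occurs in exactly one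
  factor, which gives linearity. If two arguments agree, composing with their transposition permutes
  the summands but negates each of them, so the sum equals its own negative.\<close>

lemma wedge_in_Alt:
  assumes "\<And>\<phi>. \<phi> \<in> set \<phi>s \<Longrightarrow> linear \<phi>"
  shows "wedge \<phi>s \<in> Alt (length \<phi>s)"
  unfolding Alt_def mem_Collect_eq
proof (intro conjI allI impI)
  fix vs :: "'a list" and i assume vs: "length vs = length \<phi>s" "i < length \<phi>s"
  let ?n = "length \<phi>s"
  have "linear (\<lambda>x. of_int (sign p) * (\<Prod>j<?n. (\<phi>s ! j) (vs[i := x] ! p j)))"
    if p: "p permutes {..<?n}" for p
  proof -
    have i: "i \<in> p ` {..<?n}"
      using vs permutes_image[OF p] by simp
    then obtain j where j: "j < ?n" "p j = i"
      by auto
    have *: "(\<lambda>x. of_int (sign p) * (\<Prod>j<?n. (\<phi>s ! j) (vs[i := x] ! p j))) =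
      (\<lambda>x. (of_int (sign p) * (\<Prod>j\<in>{..<?n}-{j}. (\<phi>s ! j) (vs ! p j))) *\<^sub>R (\<phi>s ! j) x)"
    proof
      fix x
      have "(\<phi>s ! j') (vs[i := x] ! p j') = (\<phi>s ! j') (vs ! p j')" if "j' \<noteq> j" for j'
        using that inj_eq[OF permutes_inj[OF p], of j j'] unfolding j(2)[symmetric] by simp
      then show "of_int (sign p) * (\<Prod>j<?n. (\<phi>s ! j) (vs[i := x] ! p j)) =
        (of_int (sign p) * (\<Prod>j\<in>{..<?n}-{j}. (\<phi>s ! j) (vs ! p j))) *\<^sub>R (\<phi>s ! j) x"
        using j vs by (subst prod.remove[of _ j]) auto
    qed
    show ?thesis
      unfolding * using assms j by (intro linear_compose_scale_right) auto
  qed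
  then show "linear (\<lambda>x. wedge \<phi>s (vs[i := x]))"
    using vs by (auto simp: wedge_def intro!: linear_compose_sum)
next
  fix vs :: "'a list" and i i' assume vs: "length vs = length \<phi>s" "i < i'" "i' < length \<phi>s" "vs ! i = vs ! i'"
  let ?n = "length \<phi>s" and ?s = "Transposition.transpose i i'"
  let ?f = "\<lambda>p. of_int (sign p) * (\<Prod>j<?n. (\<phi>s ! j) (vs ! p j)) :: real"
  have s: "?s permutes {..<?n}"
    using vs by (intro permutes_swap_id) auto
  have "?f (?s \<circ> p) = - ?f p" if p: "p permutes {..<?n}" for p
  proof -
    have "sign (?s \<circ> p) = - sign p"
      using vs p s finite_lessThan
      by (subst sign_compose) (auto simp: sign_swap_id permutation_swap_id intro: permutation_permutes[THEN iffD2])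
    moreover have "vs ! (?s \<circ> p) j = vs ! p j" for j
      using vs(4) by (auto simp: Transposition.transpose_def)
    ultimately show ?thesis
      by simp
  qed
  then have "(\<Sum>p | p permutes {..<?n}. ?f (?s \<circ> p)) = - (\<Sum>p | p permutes {..<?n}. ?f p)"
    by (simp add: sum_negf)
  moreover have "(\<Sum>p | p permutes {..<?n}. ?f (?s \<circ> p)) = (\<Sum>p | p permutes {..<?n}. ?f p)"
  proof (rule sum.reindex_bij_betw)
    show "bij_betw ((\<circ>) ?s) {p. p permutes {..<?n}} {p. p permutes {..<?n}}"
      using s by (intro bij_betw_byWitness[where f' = "(\<circ>) ?s"])
        (auto simp: fun_eq_iff intro: permutes_compose)
  qed
  ultimately show "wedge \<phi>s vs = 0"
    using vs by (simp add: wedge_def)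
qed (simp add: wedge_def)

text \<open>The functions that are alternating in each group of arguments form a subspace containing
  all products, hence containing their span.\<close>

lemma Alt2_components:
  fixes \<omega> :: "'a::euclidean_space list \<Rightarrow> 'a list \<Rightarrow> real"
  assumes "\<omega> \<in> Alt2 k m"
  shows "\<omega> ws \<in> Alt m" "(\<lambda>ws. \<omega> ws vs) \<in> Alt k"
proof -
  note Alt_simps = subspace_add[OF subspace_Alt[where 'a='a]]
    subspace_scale[OF subspace_Alt[where 'a='a]]
  let ?S = "{\<omega> :: 'a list \<Rightarrow> 'a list \<Rightarrow> real. (\<forall>ws. \<omega> ws \<in> Alt m) \<and> (\<forall>vs. (\<lambda>ws. \<omega> ws vs) \<in> Alt k)}"
  have zero: "(\<lambda>_ :: 'a list. 0 :: real) \<in> Alt j" for j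
    using subspace_0[OF subspace_Alt[of j]] unfolding zero_fun_def .
  have "subspace ?S"
  proof (rule subspaceI)
    show "0 \<in> ?S"
      using zero[of m] zero[of k] by (simp add: zero_fun_def)
  next
    fix x y assume "x \<in> ?S" "y \<in> ?S"
    then show "x + y \<in> ?S"
      using Alt_simps(1) by (fastforce simp: plus_fun_def)
  next
    fix c x assume "x \<in> ?S"
    then show "c *\<^sub>R x \<in> ?S"
      using Alt_simps(2) by (fastforce simp: scaleR_fun_def)
  qed
  moreover have "{tensor \<alpha> \<beta> |\<alpha> \<beta>. \<alpha> \<in> Alt k \<and> \<beta> \<in> Alt m} \<subseteq> ?S"
  proof clarify
    fix \<alpha> \<beta> :: "'a list \<Rightarrow> real" assume ab: "\<alpha> \<in> Alt k" "\<beta> \<in> Alt m"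
    have "tensor \<alpha> \<beta> ws = \<alpha> ws *\<^sub>R \<beta>" "(\<lambda>ws. tensor \<alpha> \<beta> ws vs) = \<beta> vs *\<^sub>R \<alpha>" for ws vs
      by (auto simp: tensor_def scaleR_fun_def)
    with ab show "(\<forall>ws. tensor \<alpha> \<beta> ws \<in> Alt m) \<and> (\<forall>vs. (\<lambda>ws. tensor \<alpha> \<beta> ws vs) \<in> Alt k)"
      using Alt_simps(2) by metis
  qed
  ultimately have "\<omega> \<in> ?S"
    using assms span_minimal unfolding Alt2_def by blast
  then show "\<omega> ws \<in> Alt m" "(\<lambda>ws. \<omega> ws vs) \<in> Alt k"
    by auto
qed

lemma linear_s_map: "linear s_map"
  by (rule linearI)
    (auto simp: s_map_def fun_eq_iff scaleR_fun_def algebra_simps sum.distrib sum_distrib_left)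

text \<open>In \<open>vs\<close> this is \<open>Alt_antisymmetrize\<close>; for fixed
  \<open>vs\<close> it is a linear combination of contractions of \<omega> in its first
  group.\<close>

lemma s_map_components:
  assumes "\<omega> \<in> Alt2 k m"
  shows "s_map \<omega> ws \<in> Alt (Suc m)" "(\<lambda>ws. s_map \<omega> ws vs) \<in> Alt (k - 1)"
proof -
  have "linear (\<lambda>v. \<omega> (v # ws) us)" for us
    using Alt_linear[OF Alt2_components(2)[OF assms], of "[]" ws us] by simp
  from Alt_antisymmetrize[OF Alt2_components(1)[OF assms] this]
  show "s_map \<omega> ws \<in> Alt (Suc m)"
    unfolding s_map_def .
  have sum: "(\<Sum>i\<in>I. f i) ws = (\<Sum>i\<in>I. f i ws :: real)" for f I and ws :: "'a list"
    by (induction I rule: infinite_finite_induct) auto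
  have "(\<lambda>ws. s_map \<omega> ws vs) =
    (\<Sum>i<length vs. (-1) ^ i *\<^sub>R (\<lambda>ws. \<omega> (vs ! i # ws) (take i vs @ drop (Suc i) vs)))"
    by (rule ext) (simp add: s_map_def scaleR_fun_def sum)
  also have "\<dots> \<in> Alt (k - 1)"
    by (intro subspace_sum subspace_scale subspace_Alt Alt_Cons[OF Alt2_components(2)[OF assms]])
  finally show "(\<lambda>ws. s_map \<omega> ws vs) \<in> Alt (k - 1)" .
qed


section \<open>Coordinates\<close>

text \<open>The functional \<open>c x\<close> vanishes on the span of the other vectors but takes
  the value 1 at \<open>P x\<close>.\<close>

lemma dual_family_independent:
  assumes lin: "\<And>x. x \<in> F \<Longrightarrow> linear (c x)"
    and dual: "\<And>x y. x \<in> F \<Longrightarrow> y \<in> F \<Longrightarrow> c x (P y) = (if x = y then 1 else 0 :: real)"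
  shows "inj_on P F" "independent (P ` F)"
proof -
  show "inj_on P F"
    by (rule inj_onI) (metis dual zero_neq_one)
  show "independent (P ` F)"
    unfolding dependent_def
  proof clarify
    fix x assume x: "x \<in> F" "P x \<in> span (P ` F - {P x})"
    have "c x v = 0" if "v \<in> span (P ` F - {P x})" for v
      using that
    proof (induction rule: span_induct)
      case base
      show ?case
        by (rule linear_subspace_kernel[OF lin[OF x(1)]])
    next
      case step
      then show ?case
        using dual x by auto
    qed
    with x dual[of x x] show False
      by auto
  qed
qed

text \<open>Makes the permutation described in \<open>eps\<close> unique.\<close>

lemma permute_list_inject:
  assumes "distinct xs" "p permutes {..<length xs}" "q permutes {..<length xs}"
    and "permute_list p xs = permute_list q xs"
  shows "p = q"
proof
  fix j
  show "p j = q j"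
  proof (cases "j < length xs")
    case True
    then have "xs ! p j = xs ! q j"
      using permute_list_nth[OF assms(2) True] permute_list_nth[OF assms(3) True] assms(4) by simp
    moreover have "p j < length xs" "q j < length xs"
      using permutes_in_image[OF assms(2), of j] permutes_in_image[OF assms(3), of j] True by auto
    ultimately show ?thesis
      using nth_eq_iff_index_eq[OF assms(1)] by blast
  next
    case False
    then show ?thesis
      using assms(2,3) by (simp add: permutes_not_in)
  qed
qed

text \<open>The algebra rests only on a coframe with a dual frame \<open>e\<close>. Tangential and
  normal vectors enter in \<open>tn_basis_dual\<close>, which constructs \<open>e\<close>.\<close>

locale coframe =
  fixes n k :: nat and dy :: "nat \<Rightarrow> 'a::euclidean_space \<Rightarrow> real" and e :: "nat \<Rightarrow> 'a"
  assumes k: "1 \<le> k" "k \<le> n"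
    and linear_dy: "\<And>i. linear (dy i)"
    and dual: "\<And>i j. i \<in> {1..n} \<Longrightarrow> j \<in> {1..n} \<Longrightarrow> dy i (e j) = (if i = j then 1 else 0)"
    and expand: "\<And>x. x = (\<Sum>j=1..n. dy j x *\<^sub>R e j)"
begin

context
  notes One_nat_def [simp del]
begin

section \<open>Evaluation of forms on increasing tuples of frame vectors\<close>

definition E :: "nat set \<Rightarrow> 'a list" where
  "E \<tau> = map e (sorted_list_of_set \<tau>)"

text \<open>Expanding every argument in the frame reduces to tuples of frame vectors. There the
  value is 0 by a repetition, by wrong length, or, after sorting, by hypothesis.\<close>

lemma Alt_eq_0:
  assumes \<alpha>: "\<alpha> \<in> Alt j" and 0: "\<And>\<tau>. \<tau> \<in> Sig j n \<Longrightarrow> \<alpha> (E \<tau>) = 0"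
  shows "\<alpha> vs = 0"
proof -
  have idx: "\<alpha> (map e is) = 0" if "set is \<subseteq> {1..n}" for "is"
  proof (cases "length is = j \<and> distinct is")
    case True
    then have "sort is = sorted_list_of_set (set is)" "set is \<in> Sig j n"
      using that by (auto simp: sorted_list_of_set_sort_remdups distinct_remdups_id Sig_def distinct_card)
    then show ?thesis
      using 0[of "set is"] Alt_sort[OF \<alpha>, of e "is"] by (simp add: E_def)
  next
    case False
    then show ?thesis
      using Alt_length[OF \<alpha>, of "map e is"] Alt_not_distinct[OF \<alpha>, of "map e is"]
      by (auto simp: distinct_map)
  qed
  \<comment> \<open>Arguments already replaced by frame vectors collect in \<open>is\<close>; the
    induction consumes \<open>us\<close>.\<close>
  have "\<alpha> (map e is @ us) = 0" if "set is \<subseteq> {1..n}" for "is" us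
    using that
  proof (induction us arbitrary: "is")
    case Nil
    then show ?case
      using idx by simp
  next
    case (Cons x us)
    have lin: "linear (\<lambda>x. \<alpha> (map e is @ x # us))"
      by (rule Alt_linear[OF \<alpha>])
    have "\<alpha> (map e is @ x # us) = (\<Sum>j=1..n. dy j x * \<alpha> (map e is @ e j # us))"
      by (subst expand[of x]) (simp add: linear_sum[OF lin] linear_scale[OF lin])
    also have "\<dots> = 0"
    proof (rule sum.neutral, rule ballI)
      fix j assume "j \<in> {1..n}"
      then show "dy j x * \<alpha> (map e is @ e j # us) = 0"
        using Cons.IH[of "is @ [j]"] Cons.prems by simp
    qed
    finally show ?case .
  qed
  from this[of "[]"] show ?thesis
    by simp
qed

text \<open>The matrix of pairings is a permutation matrix, so \<open>q = p\<close> is the only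
  surviving term of the determinant. The case \<open>p = id\<close> gives the dual pairing, the
  general case the signs \<open>eps\<close>.\<close>

lemma wedge_permute:
  assumes xs: "distinct xs" "set xs \<subseteq> {1..n}" and p: "p permutes {..<length xs}"
  shows "wedge (map dy (permute_list p xs)) (map e xs) = of_int (sign p)"
proof -
  let ?m = "length xs"
  have "(\<Prod>j<?m. dy (permute_list p xs ! j) (e (xs ! q j))) = (if q = p then 1 else 0)"
    if q: "q permutes {..<?m}" for q
  proof -
    have eq: "dy (permute_list p xs ! j) (e (xs ! q j)) = (if p j = q j then 1 else 0)" if "j < ?m" for j
    proof -
      have "p j < ?m" "q j < ?m"
        using permutes_in_image[OF p, of j] permutes_in_image[OF q, of j] that by auto
      moreover from this have "xs ! p j \<in> {1..n}" "xs ! q j \<in> {1..n}"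
        using xs(2) nth_mem by blast+
      ultimately show ?thesis
        using xs(1) that p by (simp add: permute_list_nth dual nth_eq_iff_index_eq)
    qed
    show ?thesis
    proof (cases "q = p")
      case False
      then obtain j where "q j \<noteq> p j"
        by auto
      moreover from this have "j < ?m"
        using p q by (metis lessThan_iff permutes_not_in)
      ultimately show ?thesis
        using False eq by (auto intro!: prod_zero bexI[of _ j])
    next
      case True
      have "(\<Prod>j<?m. dy (permute_list p xs ! j) (e (xs ! q j))) = (\<Prod>j<?m. 1)"
        using True eq by (intro prod.cong) (simp_all del: permute_list_nth)
      with True show ?thesis
        by simp
    qed
  qed
  moreover have "(\<Prod>j<?m. (map dy (permute_list p xs) ! j) (map e xs ! q j)) =
    (\<Prod>j<?m. dy (permute_list p xs ! j) (e (xs ! q j)))" if "q permutes {..<?m}" for q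
    using permutes_in_image[OF that] by (intro prod.cong) auto
  ultimately have "wedge (map dy (permute_list p xs)) (map e xs) =
    (\<Sum>q | q permutes {..<?m}. if q = p then of_int (sign p) else 0)"
    unfolding wedge_def by (auto intro!: sum.cong)
  also have "\<dots> = of_int (sign p)"
    using p by (simp add: sum.delta finite_permutations)
  finally show ?thesis .
qed

text \<open>The row of \<open>dy z\<close> in the determinant is zero, since \<open>z\<close>
  differs from every index in \<open>xs\<close>.\<close>

lemma wedge_eq_0:
  assumes "set xs \<subseteq> {1..n}" "set zs \<subseteq> {1..n}" and z: "z \<in> set zs" "z \<notin> set xs"
  shows "wedge (map dy zs) (map e xs) = 0"
proof (cases "length xs = length zs")
  case True
  obtain j where j: "j < length zs" "zs ! j = z"
    using z by (auto simp: in_set_conv_nth)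
  have "(\<Prod>j<length zs. (map dy zs ! j) (map e xs ! p j)) = 0" if "p permutes {..<length zs}" for p
  proof (rule prod_zero)
    have "p j < length xs"
      using permutes_in_image[OF that, of j] j True by auto
    then show "\<exists>j\<in>{..<length zs}. (map dy zs ! j) (map e xs ! p j) = 0"
      using j z assms dual[of z "xs ! p j"] nth_mem[of "p j" xs] True by (intro bexI[of _ j]) force+
  qed simp
  then show ?thesis
    unfolding wedge_def by (auto intro!: sum.neutral)
qed (simp add: wedge_def)

lemma dy_wedge_in_Alt: "dy_wedge dy \<sigma> \<in> Alt (card \<sigma>)"
  using wedge_in_Alt[of "map dy (sorted_list_of_set \<sigma>)"] linear_dy by (auto simp: dy_wedge_def)

lemma Sig_finite: "\<sigma> \<in> Sig j n \<Longrightarrow> finite \<sigma>"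
  by (auto simp: Sig_def intro: finite_subset)

lemma finite_Sig: "finite (Sig j n)"
  unfolding Sig_def by (rule finite_subset[of _ "Pow {1..n}"]) auto

lemma Sig_neqE:
  assumes "\<sigma> \<in> Sig j n" "\<tau> \<in> Sig j n" "\<sigma> \<noteq> \<tau>"
  obtains z where "z \<in> \<sigma>" "z \<notin> \<tau>"
  using assms card_subset_eq[OF Sig_finite[OF assms(2)], of \<sigma>] by (auto simp: Sig_def)

lemma dy_wedge_E:
  assumes "\<sigma> \<in> Sig j n" "\<tau> \<in> Sig j n"
  shows "dy_wedge dy \<sigma> (E \<tau>) = (if \<sigma> = \<tau> then 1 else 0)"
proof (cases "\<sigma> = \<tau>")
  case True
  have "dy_wedge dy \<tau> (E \<tau>) = 1"
    using wedge_permute[of "sorted_list_of_set \<tau>" id] assms(2) Sig_finite[OF assms(2)]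
    by (simp add: dy_wedge_def E_def Sig_def permutes_id sign_id)
  with True show ?thesis
    by simp
next
  case False
  then obtain z where "z \<in> \<sigma>" "z \<notin> \<tau>"
    using assms Sig_neqE by metis
  then show ?thesis
    using False assms Sig_finite[OF assms(1)] Sig_finite[OF assms(2)]
    by (auto simp: dy_wedge_def E_def Sig_def intro!: wedge_eq_0)
qed

text \<open>Source of the signs \<open>eps\<close>: sorting \<open>i\<close> into \<tau> turns the
  tuple into \<open>E (insert i \<tau>)\<close>. If \<open>i \<in> \<tau>\<close> a vector repeats,
  and if \<sigma> is a different set, some covector of \<sigma> kills all the vectors.\<close>

lemma dy_wedge_Cons_E:
  assumes \<sigma>: "\<sigma> \<in> Sig k n" and \<tau>: "\<tau> \<in> Sig (k - 1) n" and i: "i \<in> {1..n}"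
  shows "dy_wedge dy \<sigma> (e i # E \<tau>) = (if i \<notin> \<tau> \<and> \<sigma> = insert i \<tau> then of_int (eps i \<tau>) else 0)"
proof (cases "i \<in> \<tau>")
  case True
  then have "\<not> distinct (e i # E \<tau>)"
    using Sig_finite[OF \<tau>] by (auto simp: E_def)
  then show ?thesis
    using True Alt_not_distinct[OF dy_wedge_in_Alt] by auto
next
  case False
  let ?xs = "i # sorted_list_of_set \<tau>" and ?zs = "sorted_list_of_set \<sigma>"
  have fin: "finite \<sigma>" "finite \<tau>"
    using \<sigma> \<tau> Sig_finite by auto
  have xs: "distinct ?xs" "set ?xs = insert i \<tau>" "set ?xs \<subseteq> {1..n}"
    using False i \<tau> fin by (auto simp: Sig_def)
  have ins: "insert i \<tau> \<in> Sig k n"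
    using False i \<tau> fin k by (auto simp: Sig_def)
  have \<omega>: "dy_wedge dy \<sigma> (e i # E \<tau>) = wedge (map dy ?zs) (map e ?xs)"
    by (simp add: dy_wedge_def E_def)
  show ?thesis
  proof (cases "\<sigma> = insert i \<tau>")
    case True
    then have "mset ?zs = mset ?xs"
      using set_eq_iff_mset_eq_distinct[of ?zs ?xs] xs(1,2) fin(1) by simp
    then obtain p where p: "p permutes {..<length ?xs}" "permute_list p ?xs = ?zs"
      using mset_eq_permutation by blast
    \<comment> \<open>Sorting distinct entries has a single outcome, and that outcome determines the
      permutation.\<close>
    have "eps i \<tau> = sign p"
      unfolding eps_def Let_def
    proof (rule arg_cong[where f = sign], rule the_equality)
      show "p permutes {..<length ?xs} \<and> sorted (permute_list p ?xs)"
        using p by simp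
    next
      fix q assume q: "q permutes {..<length ?xs} \<and> sorted (permute_list q ?xs)"
      then have "permute_list q ?xs = ?zs"
        using True fin(1) xs(1,2)
        by (intro sorted_distinct_set_unique) (simp_all only: set_permute_list distinct_permute_list
          sorted_sorted_list_of_set distinct_sorted_list_of_set set_sorted_list_of_set)
      then show "q = p"
        using permute_list_inject[OF xs(1)] p q by metis
    qed
    then show ?thesis
      using \<omega> wedge_permute[OF xs(1,3) p(1)] p(2) True False by simp
  next
    case neq: False
    then obtain z where "z \<in> \<sigma>" "z \<notin> insert i \<tau>"
      using \<sigma> ins Sig_neqE by metis
    then have "wedge (map dy ?zs) (map e ?xs) = 0"
      using \<sigma> fin xs by (intro wedge_eq_0[of _ _ z]) (auto simp: Sig_def)
    with \<omega> neq show ?thesis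
      by simp
  qed
qed

section \<open>Coordinates of double forms\<close>

definition coef :: "nat set \<times> nat \<Rightarrow> ('a list \<Rightarrow> 'a list \<Rightarrow> real) \<Rightarrow> real" where
  "coef x \<omega> = (-1) ^ (snd x - 1) * \<omega> (E (fst x)) (E ({1..n} - {snd x}))"

lemma linear_coef: "linear (coef x)"
  by (rule linearI) (auto simp: coef_def scaleR_fun_def algebra_simps)

lemma basis_elt_Alt2:
  assumes "x \<in> all_indices n k"
  shows "basis_elt n dy x \<in> Alt2 k (n - 1)"
proof -
  obtain \<sigma> i where x: "x = (\<sigma>, i)" "\<sigma> \<in> Sig k n" "i \<in> {1..n}"
    using assms by (auto simp: all_indices_def)
  have "dy_wedge dy \<sigma> \<in> Alt k"
    using dy_wedge_in_Alt[of \<sigma>] x by (simp add: Sig_def)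
  moreover have "dy_star n dy i \<in> Alt (n - 1)"
    using dy_wedge_in_Alt[of "{1..n} - {i}"] x
    by (auto simp: dy_star_def intro: subspace_scale[OF subspace_Alt])
  ultimately show ?thesis
    by (auto simp: x Alt2_def basis_elt_def intro: span_base)
qed

lemma complement_Sig: "i \<in> {1..n} \<Longrightarrow> {1..n} - {i} \<in> Sig (n - 1) n"
  by (auto simp: Sig_def)

text \<open>The prefactor is the one in \<open>coef\<close>; for \<open>i = j\<close> it cancels the
  sign built into \<open>dy_star\<close>.\<close>

lemma dy_star_E:
  assumes "i \<in> {1..n}" "j \<in> {1..n}"
  shows "(-1) ^ (j - 1) * dy_star n dy i (E ({1..n} - {j})) = (if i = j then 1 else 0)"
proof -
  have "{1..n} - {i} = {1..n} - {j} \<longleftrightarrow> i = j"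
    using assms by blast
  then show ?thesis
    using dy_wedge_E[OF complement_Sig complement_Sig, OF assms]
    by (auto simp: dy_star_def scaleR_fun_def simp flip: power_add mult_2)
qed

lemma coef_basis_elt:
  assumes "x \<in> all_indices n k" "y \<in> all_indices n k"
  shows "coef x (basis_elt n dy y) = (if x = y then 1 else 0)"
proof -
  obtain \<sigma> i \<rho> j where x: "x = (\<sigma>, i)" "\<sigma> \<in> Sig k n" "i \<in> {1..n}"
    and y: "y = (\<rho>, j)" "\<rho> \<in> Sig k n" "j \<in> {1..n}"
    using assms by (auto simp: all_indices_def)
  have "coef x (basis_elt n dy y) =
    dy_wedge dy \<rho> (E \<sigma>) * ((-1) ^ (i - 1) * dy_star n dy j (E ({1..n} - {i})))"
    by (simp add: x y coef_def basis_elt_def tensor_def)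
  then show ?thesis
    using x y by (auto simp: dy_wedge_E dy_star_E)
qed

text \<open>\<open>Alt_eq_0\<close> applied in each group of arguments. An index set of size
  \<open>n - 1\<close> is the complement of a single point, so the remaining values are coordinates
  up to sign.\<close>

lemma Alt2_eq_0:
  assumes \<omega>: "\<omega> \<in> Alt2 k (n - 1)" and 0: "\<And>x. x \<in> all_indices n k \<Longrightarrow> coef x \<omega> = 0"
  shows "\<omega> = 0"
proof -
  have "\<omega> ws vs = 0" for ws vs
  proof (rule Alt_eq_0[OF Alt2_components(2)[OF \<omega>]])
    fix \<sigma> assume \<sigma>: "\<sigma> \<in> Sig k n"
    show "\<omega> (E \<sigma>) vs = 0"
    proof (rule Alt_eq_0[OF Alt2_components(1)[OF \<omega>]])
      fix \<rho> assume \<rho>: "\<rho> \<in> Sig (n - 1) n"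
      then have "card ({1..n} - \<rho>) = 1"
        using k by (auto simp: Sig_def card_Diff_subset finite_subset)
      then obtain i where i: "{1..n} - \<rho> = {i}"
        using card_1_singletonE by blast
      then have "\<rho> = {1..n} - {i}" "i \<in> {1..n}"
        using \<rho> by (auto simp: Sig_def)
      then show "\<omega> (E \<sigma>) (E \<rho>) = 0"
        using 0[of "(\<sigma>, i)"] \<sigma> by (simp add: coef_def all_indices_def)
    qed
  qed
  then show ?thesis
    by (auto simp: fun_eq_iff)
qed

section \<open>The equations that describe the kernel of \<open>s_map\<close>\<close>

lemma s_map_E:
  "s_map \<omega> (E \<tau>) (E {1..n}) =
    (\<Sum>i=1..n. (-1) ^ (i - 1) * \<omega> (e i # E \<tau>) (E ({1..n} - {i})))"
proof -
  have E: "E {1..n} = map e [1..<Suc n]"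
    by (simp add: E_def atLeastLessThanSuc_atLeastAtMost[symmetric] del: upt_Suc)
  \<comment> \<open>List positions start at 0 but frame indices at 1.\<close>
  have "E {1..n} ! i = e (Suc i)"
    "take i (E {1..n}) @ drop (Suc i) (E {1..n}) = E ({1..n} - {Suc i})" if "i < n" for i
  proof -
    show "E {1..n} ! i = e (Suc i)"
      using that unfolding E by (simp add: One_nat_def del: upt_Suc)
    have "[1..<Suc i] @ [Suc (Suc i)..<Suc n] = sorted_list_of_set ({1..n} - {Suc i})"
      using that by (intro sorted_distinct_set_unique) (auto simp: sorted_append simp del: upt_Suc)
    then show "take i (E {1..n}) @ drop (Suc i) (E {1..n}) = E ({1..n} - {Suc i})"
      using that unfolding E by (simp add: E_def[of "{Suc 0..n} - {Suc i}"] take_map drop_map take_upt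
        One_nat_def flip: map_append del: upt_Suc)
  qed
  moreover have "length (E {1..n}) = n"
    by (simp add: E del: upt_Suc)
  ultimately show ?thesis
    by (simp add: s_map_def sum.atLeast1_atMost_eq One_nat_def)
qed

text \<open>The second group now has \<open>n\<close> arguments, and \<open>E {1..n}\<close> is the
  only increasing tuple of that length, leaving one scalar equation per \<tau>.\<close>

lemma s_map_eq_0:
  assumes \<omega>: "\<omega> \<in> Alt2 k (n - 1)"
    and 0: "\<And>\<tau>. \<tau> \<in> Sig (k - 1) n \<Longrightarrow> s_map \<omega> (E \<tau>) (E {1..n}) = 0"
  shows "s_map \<omega> = 0"
proof -
  have n: "Suc (n - 1) = n"
    using k by simp
  have "s_map \<omega> ws vs = 0" for ws vs
  proof (rule Alt_eq_0[OF s_map_components(2)[OF \<omega>]])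
    fix \<tau> assume \<tau>: "\<tau> \<in> Sig (k - 1) n"
    show "s_map \<omega> (E \<tau>) vs = 0"
    proof (rule Alt_eq_0[OF s_map_components(1)[OF \<omega>, unfolded n]])
      fix \<rho> assume "\<rho> \<in> Sig n n"
      then have "\<rho> = {1..n}"
        using card_subset_eq[of "{1..n}" \<rho>] by (simp add: Sig_def)
      then show "s_map \<omega> (E \<tau>) (E \<rho>) = 0"
        using 0 \<tau> by simp
    qed
  qed
  then show ?thesis
    by (auto simp: fun_eq_iff)
qed

text \<open>The pairing \<open>dy_star_E\<close> leaves only the summand \<open>j = i\<close>. So
  the equation of \<tau> involves precisely the indices of the constraint sequence of \<tau>, with
  coefficients \<open>eps i \<tau>\<close>.\<close>

lemma s_map_basis_elt:
  assumes "\<sigma> \<in> Sig k n" "i \<in> {1..n}" "\<tau> \<in> Sig (k - 1) n"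
  shows "s_map (basis_elt n dy (\<sigma>, i)) (E \<tau>) (E {1..n}) =
    (if i \<notin> \<tau> \<and> \<sigma> = insert i \<tau> then of_int (eps i \<tau>) else 0)"
proof -
  have "s_map (basis_elt n dy (\<sigma>, i)) (E \<tau>) (E {1..n}) =
    (\<Sum>j=1..n. dy_wedge dy \<sigma> (e j # E \<tau>) * ((-1) ^ (j - 1) * dy_star n dy i (E ({1..n} - {j}))))"
    unfolding s_map_E by (simp add: basis_elt_def tensor_def mult_ac)
  also have "\<dots> = (\<Sum>j=1..n. if j = i then dy_wedge dy \<sigma> (e i # E \<tau>) else 0)"
    using assms(2) by (intro sum.cong refl) (subst dy_star_E, auto)
  also have "\<dots> = dy_wedge dy \<sigma> (e i # E \<tau>)"
    using assms(2) by simp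
  finally show ?thesis
    using dy_wedge_Cons_E[OF assms(1,3,2)] by simp
qed

section \<open>The oblique projection\<close>

lemma complement_nonempty:
  assumes "\<tau> \<in> Sig (k - 1) n"
  shows "finite ({1..n} - \<tau>)" "{1..n} - \<tau> \<noteq> {}"
proof -
  show "{1..n} - \<tau> \<noteq> {}"
  proof
    assume "{1..n} - \<tau> = {}"
    then have "\<tau> = {1..n}"
      using assms by (auto simp: Sig_def)
    then show False
      using assms k by (auto simp: Sig_def)
  qed
qed simp

lemma pair_index_eq:
  assumes "\<tau> \<in> Sig (k - 1) n"
  shows "pair_index n \<tau> = (insert (Min ({1..n} - \<tau>)) \<tau>, Min ({1..n} - \<tau>))"
  using sorted_list_of_set_nonempty[OF complement_nonempty[OF assms]]
  by (simp add: pair_index_def constraint_seq_def)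

lemma Min_complement:
  assumes "\<tau> \<in> Sig (k - 1) n"
  shows "Min ({1..n} - \<tau>) \<in> {1..n}" "Min ({1..n} - \<tau>) \<notin> \<tau>"
  using Min_in[OF complement_nonempty[OF assms]] by auto

lemma insert_Sig:
  assumes "\<tau> \<in> Sig (k - 1) n" "i \<in> {1..n}" "i \<notin> \<tau>"
  shows "insert i \<tau> \<in> Sig k n"
  using assms k Sig_finite[OF assms(1)] by (auto simp: Sig_def)

lemma pair_index_all:
  assumes "\<tau> \<in> Sig (k - 1) n"
  shows "pair_index n \<tau> \<in> all_indices n k"
  using insert_Sig[OF assms Min_complement[OF assms]] Min_complement[OF assms] assms
  by (simp add: pair_index_eq all_indices_def)

text \<open>Removing the second component from the first recovers \<tau>.\<close>

lemma inj_on_pair_index: "inj_on (pair_index n) (Sig (k - 1) n)"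
proof (rule inj_onI)
  fix \<tau> \<tau>' assume \<tau>: "\<tau> \<in> Sig (k - 1) n" "\<tau>' \<in> Sig (k - 1) n" "pair_index n \<tau> = pair_index n \<tau>'"
  have "Min ({1..n} - \<tau>) = Min ({1..n} - \<tau>')"
    "insert (Min ({1..n} - \<tau>)) \<tau> = insert (Min ({1..n} - \<tau>')) \<tau>'"
    using \<tau>(3) unfolding pair_index_eq[OF \<tau>(1)] pair_index_eq[OF \<tau>(2)] prod.inject by blast+
  with Min_complement(2)[OF \<tau>(1)] Min_complement(2)[OF \<tau>(2)] show "\<tau> = \<tau>'"
    by (metis insert_ident)
qed

lemma Diff_Sig:
  assumes "\<sigma> \<in> Sig k n" "i \<in> \<sigma>"
  shows "\<sigma> - {i} \<in> Sig (k - 1) n"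
  using assms by (auto simp: Sig_def)

text \<open>If \<open>i \<notin> \<sigma>\<close>, the element occurs in no equation. Otherwise both
  terms of the projection occur only in the equation of \<open>\<tau> = \<sigma> - {i}\<close>,
  where they cancel because the square of \<open>eps m \<tau>\<close> is 1.\<close>

lemma proj_value_XX:
  assumes "x \<in> all_indices n k"
  shows "proj_value n dy x \<in> XX n k"
proof -
  obtain \<sigma> i where x: "x = (\<sigma>, i)" "\<sigma> \<in> Sig k n" "i \<in> {1..n}"
    using assms by (auto simp: all_indices_def)
  note B = basis_elt_Alt2[OF assms, unfolded x]
  show ?thesis
  proof (cases "i \<in> \<sigma>")
    case False
    then have "proj_value n dy x = basis_elt n dy (\<sigma>, i)"
      by (simp add: x proj_value_def)
    moreover have "s_map (basis_elt n dy (\<sigma>, i)) = 0"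
      using False x by (intro s_map_eq_0[OF B]) (auto simp: s_map_basis_elt)
    ultimately show ?thesis
      using B by (simp add: XX_def)
  next
    case True
    define \<tau> where "\<tau> = \<sigma> - {i}"
    define m where "m = Min ({1..n} - \<tau>)"
    define c where "c = real_of_int (eps i \<tau> * eps m \<tau>)"
    have \<tau>: "\<tau> \<in> Sig (k - 1) n" "i \<notin> \<tau>" "insert i \<tau> = \<sigma>"
      unfolding \<tau>_def using x True Diff_Sig by auto
    have m: "m \<in> {1..n}" "m \<notin> \<tau>" "insert m \<tau> \<in> Sig k n"
      unfolding m_def using Min_complement[OF \<tau>(1)] insert_Sig[OF \<tau>(1)] by auto
    have P: "proj_value n dy x = basis_elt n dy (\<sigma>, i) - c *\<^sub>R basis_elt n dy (insert m \<tau>, m)"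
      using True by (simp add: x proj_value_def Let_def \<tau>_def[symmetric] pair_index_eq[OF \<tau>(1)]
        m_def[symmetric] c_def)
    have "basis_elt n dy (insert m \<tau>, m) \<in> Alt2 k (n - 1)"
      using m by (intro basis_elt_Alt2) (simp add: all_indices_def)
    with B have A: "proj_value n dy x \<in> Alt2 k (n - 1)"
      unfolding P Alt2_def by (intro span_diff span_scale)
    have sign: "eps m \<tau> * eps m \<tau> = 1"
      by (simp add: eps_def Let_def sign_def)
    have "s_map (proj_value n dy x) = 0"
    proof (rule s_map_eq_0[OF A])
      fix \<tau>' assume \<tau>': "\<tau>' \<in> Sig (k - 1) n"
      have "s_map (proj_value n dy x) (E \<tau>') (E {1..n}) =
        s_map (basis_elt n dy (\<sigma>, i)) (E \<tau>') (E {1..n}) -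
        c * s_map (basis_elt n dy (insert m \<tau>, m)) (E \<tau>') (E {1..n})"
        unfolding P linear_diff[OF linear_s_map] linear_scale[OF linear_s_map] by (simp add: scaleR_fun_def)
      moreover have "i \<notin> \<tau>' \<and> \<sigma> = insert i \<tau>' \<longleftrightarrow> \<tau>' = \<tau>"
        unfolding \<tau>_def using True by auto
      moreover have "m \<notin> \<tau>' \<and> insert m \<tau> = insert m \<tau>' \<longleftrightarrow> \<tau>' = \<tau>"
        using m(2) by (auto simp: insert_ident)
      moreover have "real_of_int (eps m \<tau>) * real_of_int (eps m \<tau>) = 1"
        using sign by (metis of_int_1 of_int_mult)
      ultimately show "s_map (proj_value n dy x) (E \<tau>') (E {1..n}) = 0"
        using x m \<tau>' by (simp add: s_map_basis_elt c_def)
    qed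
    with A show ?thesis
      by (simp add: XX_def)
  qed
qed

text \<open>Every index of a constraint sequence except its first is free. With the free coordinates
  zero, the equation of \<tau> forces the coordinate at its pair index to vanish too.\<close>

lemma XX_eq_0:
  assumes \<omega>: "\<omega> \<in> XX n k" and free: "\<And>x. x \<in> free_indices n k \<Longrightarrow> coef x \<omega> = 0"
  shows "\<omega> = 0"
proof (rule Alt2_eq_0)
  show A: "\<omega> \<in> Alt2 k (n - 1)"
    using \<omega> by (simp add: XX_def)
  fix x assume x: "x \<in> all_indices n k"
  show "coef x \<omega> = 0"
  proof (cases "x \<in> free_indices n k")
    case False
    then obtain \<tau> where \<tau>: "\<tau> \<in> Sig (k - 1) n" "x = pair_index n \<tau>"
      using x by (auto simp: free_indices_def)
    define m where "m = Min ({1..n} - \<tau>)"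
    have m: "m \<in> {1..n}" "m \<notin> \<tau>" and xm: "x = (insert m \<tau>, m)"
      using Min_complement[OF \<tau>(1)] \<tau> by (auto simp: m_def pair_index_eq)
    \<comment> \<open>Terms of the equation and coordinates of \<omega> differ by signs only, so
      vanishing passes between them.\<close>
    have swap: "\<omega> (e i # E \<tau>) us = 0 \<longleftrightarrow> \<omega> (E (insert i \<tau>)) us = 0" if "i \<notin> \<tau>" for i us
      using Alt_sort[OF Alt2_components(2)[OF A, of us], of e "i # sorted_list_of_set \<tau>"] that
        Sig_finite[OF \<tau>(1)] by (simp add: E_def sorted_sort_id)
    have "\<omega> (e i # E \<tau>) (E ({1..n} - {i})) = 0" if i: "i \<in> {1..n}" "i \<noteq> m" for i
    proof (cases "i \<in> \<tau>")
      case True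
      then have "\<not> distinct (e i # E \<tau>)"
        using Sig_finite[OF \<tau>(1)] by (auto simp: E_def)
      then show ?thesis
        using Alt_not_distinct[OF Alt2_components(2)[OF A]] by blast
    next
      case False
      \<comment> \<open>A set \<tau>' with this pair index would equal \<tau>, whose pair index has
        second component \<open>m\<close>, not \<open>i\<close>.\<close>
      have "(insert i \<tau>, i) \<notin> pair_index n ` Sig (k - 1) n"
      proof
        assume "(insert i \<tau>, i) \<in> pair_index n ` Sig (k - 1) n"
        then obtain \<tau>' where \<tau>': "\<tau>' \<in> Sig (k - 1) n" "pair_index n \<tau>' = (insert i \<tau>, i)"
          by auto
        then have "i \<notin> \<tau>'" "insert i \<tau>' = insert i \<tau>" "i = Min ({1..n} - \<tau>')"
          using Min_complement(2)[OF \<tau>'(1)] by (auto simp: pair_index_eq)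
        with False i show False
          unfolding m_def by (metis insert_ident)
      qed
      then have "coef (insert i \<tau>, i) \<omega> = 0"
        using insert_Sig[OF \<tau>(1) i(1) False] i by (intro free) (simp add: free_indices_def all_indices_def)
      then show ?thesis
        using swap[OF False] by (simp add: coef_def)
    qed
    then have "s_map \<omega> (E \<tau>) (E {1..n}) = (\<Sum>i=1..n. if i = m then (-1) ^ (m - 1) * \<omega> (e m # E \<tau>) (E ({1..n} - {m})) else 0)"
      unfolding s_map_E by (intro sum.cong) auto
    moreover have "s_map \<omega> (E \<tau>) (E {1..n}) = 0"
      using \<omega> by (simp add: XX_def)
    ultimately have "\<omega> (e m # E \<tau>) (E ({1..n} - {m})) = 0"
      using m by simp
    then show ?thesis
      using swap[OF m(2)] xm by (simp add: coef_def)
  qed (rule free)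
qed

text \<open>The projection alters a basis element only by a multiple of a pair-index element, which
  free coordinates do not see.\<close>

lemma coef_proj_value:
  assumes "x \<in> free_indices n k" "y \<in> free_indices n k"
  shows "coef x (proj_value n dy y) = (if x = y then 1 else 0)"
proof -
  have xy: "x \<in> all_indices n k" "y \<in> all_indices n k"
    using assms by (auto simp: free_indices_def)
  show ?thesis
  proof (cases "snd y \<in> fst y")
    case True
    define \<tau> where "\<tau> = fst y - {snd y}"
    have \<tau>: "\<tau> \<in> Sig (k - 1) n"
      unfolding \<tau>_def using True xy by (intro Diff_Sig) (auto simp: all_indices_def)
    have "proj_value n dy y = basis_elt n dy y -
      real_of_int (eps (snd y) \<tau> * eps (snd (pair_index n \<tau>)) \<tau>) *\<^sub>R basis_elt n dy (pair_index n \<tau>)"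
      using True by (simp add: proj_value_def \<tau>_def Let_def case_prod_beta)
    moreover have "x \<noteq> pair_index n \<tau>"
      using assms \<tau> by (auto simp: free_indices_def)
    ultimately show ?thesis
      using xy pair_index_all[OF \<tau>]
      by (simp add: linear_diff[OF linear_coef] linear_scale[OF linear_coef] coef_basis_elt)
  next
    case False
    then show ?thesis
      using xy by (simp add: proj_value_def case_prod_beta coef_basis_elt)
  qed
qed

section \<open>The projected free elements as a basis of the kernel\<close>

lemma finite_free: "finite (free_indices n k)"
  by (auto simp: free_indices_def all_indices_def finite_Sig)

lemma subspace_XX: "subspace (XX n k :: ('a list \<Rightarrow> 'a list \<Rightarrow> real) set)"
  unfolding XX_def Alt2_def
  using subspace_inter[OF subspace_span linear_subspace_kernel[OF linear_s_map]]
  by (simp add: Int_def)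

text \<open>Subtracting from \<omega> the combination weighted by its own free coordinates leaves a
  kernel element whose free coordinates vanish.\<close>

lemma XX_eq_span:
  "(XX n k :: ('a list \<Rightarrow> 'a list \<Rightarrow> real) set) = span (proj_value n dy ` free_indices n k)"
proof
  show "span (proj_value n dy ` free_indices n k) \<subseteq> XX n k"
    using proj_value_XX by (intro span_minimal subspace_XX) (auto simp: free_indices_def)
  show "(XX n k :: ('a list \<Rightarrow> 'a list \<Rightarrow> real) set) \<subseteq> span (proj_value n dy ` free_indices n k)"
  proof
    fix \<omega> :: "'a list \<Rightarrow> 'a list \<Rightarrow> real"
    assume \<omega>: "\<omega> \<in> XX n k"
    let ?\<eta> = "\<Sum>x\<in>free_indices n k. coef x \<omega> *\<^sub>R proj_value n dy x"
    have "\<omega> - ?\<eta> = 0"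
    proof (rule XX_eq_0)
      show "\<omega> - ?\<eta> \<in> XX n k"
        using \<omega> proj_value_XX
        by (intro subspace_diff subspace_sum subspace_scale subspace_XX) (auto simp: free_indices_def)
      fix x assume "x \<in> free_indices n k"
      then show "coef x (\<omega> - ?\<eta>) = 0"
        using finite_free
        by (simp add: linear_diff[OF linear_coef] linear_sum[OF linear_coef] linear_scale[OF linear_coef]
          coef_proj_value if_distrib[of "\<lambda>t. _ * t"] cong: if_cong)
    qed
    then have "\<omega> = ?\<eta>"
      by simp
    also have "?\<eta> \<in> span (proj_value n dy ` free_indices n k)"
      by (intro span_sum span_scale span_base) auto
    finally show "\<omega> \<in> span (proj_value n dy ` free_indices n k)" .
  qed
qed

text \<open>Duality with \<open>coef\<close> makes the basis elements distinct and independent, so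
  \<open>proj_XX\<close> attains its prescribed values.\<close>

lemma proj_XX_basis:
  assumes "x \<in> all_indices n k"
  shows "proj_XX n k dy (basis_elt n dy x) = proj_value n dy x"
  using dual_family_independent[of "all_indices n k" coef "basis_elt n dy"] linear_coef coef_basis_elt assms
  by (intro proj_XX_basis_elt) auto

lemma dim_span_proj_value:
  assumes "F \<subseteq> free_indices n k"
  shows "dim (span (proj_value n dy ` F)) = card F"
proof -
  have "inj_on (proj_value n dy) F" "independent (proj_value n dy ` F)"
    using dual_family_independent[of F coef "proj_value n dy"] linear_coef coef_proj_value assms by blast+
  then show ?thesis
    by (simp add: dim_eq_card_independent card_image)
qed

text \<open>Elements of either span have zero coordinates at the free indices of the other family,
  so a common element has no nonzero free coordinate.\<close>

lemma span_proj_value_disjoint: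
  assumes "F \<union> G = free_indices n k" "F \<inter> G = {}"
  shows "span (proj_value n dy ` F) \<inter> span (proj_value n dy ` G) = {0}"
proof -
  have 0: "coef x \<omega> = 0" if "\<omega> \<in> span (proj_value n dy ` H)" "H \<subseteq> free_indices n k" "x \<in> free_indices n k - H" for x \<omega> H
    using that(1)
  proof (induction rule: span_induct)
    case base
    show ?case
      by (rule linear_subspace_kernel[OF linear_coef])
  next
    case step
    then show ?case
      using that(2,3) by (auto simp: coef_proj_value)
  qed
  have "\<omega> = 0" if \<omega>: "\<omega> \<in> span (proj_value n dy ` F)" "\<omega> \<in> span (proj_value n dy ` G)" for \<omega>
  proof (rule XX_eq_0)
    show "\<omega> \<in> XX n k"
      using \<omega>(1) span_mono[OF image_mono, of F "free_indices n k"] assms(1)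
      unfolding XX_eq_span by blast
    fix x assume "x \<in> free_indices n k"
    then show "coef x \<omega> = 0"
      using 0[OF \<omega>(1), of x] 0[OF \<omega>(2), of x] assms by (cases "x \<in> F") auto
  qed
  then show ?thesis
    by (auto intro: span_zero)
qed

section \<open>Counting free indices\<close>

lemma card_Sig: "card (Sig j n) = n choose j"
  using n_subsets[of "{1..n}" j] by (simp add: Sig_def)

text \<open>From all indices with second component in \<open>A\<close> the pair indices are removed,
  one for each \<tau> by injectivity. Integers keep the subtraction exact.\<close>

lemma card_free_indices:
  assumes "A \<subseteq> {1..n}"
  shows "int (card {x \<in> free_indices n k. snd x \<in> A}) =
    int (card A) * int (n choose k) - int (card {\<tau> \<in> Sig (k - 1) n. Min ({1..n} - \<tau>) \<in> A})"
proof -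
  let ?S = "{\<tau> \<in> Sig (k - 1) n. Min ({1..n} - \<tau>) \<in> A}"
  have "{x \<in> free_indices n k. snd x \<in> A} = Sig k n \<times> A - pair_index n ` ?S"
    using assms by (auto simp: free_indices_def all_indices_def pair_index_eq image_iff)
  moreover have sub: "pair_index n ` ?S \<subseteq> Sig k n \<times> A"
    using pair_index_all by (auto simp: all_indices_def pair_index_eq)
  moreover have fin: "finite (Sig k n \<times> A)"
    using assms finite_Sig finite_subset by blast
  moreover have "card (pair_index n ` ?S) = card ?S"
    using inj_on_pair_index by (intro card_image) (auto elim: inj_on_subset)
  moreover have "card (pair_index n ` ?S) \<le> card (Sig k n \<times> A)"
    using sub fin by (rule card_mono[rotated])
  ultimately show ?thesis
    by (simp only:) (simp add: card_Diff_subset finite_subset[OF sub fin] of_nat_diff card_cartesian_product card_Sig)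
qed

text \<open>The minimum of the complement exceeds \<open>l\<close> iff the whole complement does, so
  complementation matches these \<tau> with subsets of \<open>{l+1..n}\<close>.\<close>

lemma card_Min_complement:
  assumes "l \<le> n"
  shows "card {\<tau> \<in> Sig (k - 1) n. Min ({1..n} - \<tau>) \<in> {l+1..n}} = (n - l) choose (n - k + 1)"
proof -
  let ?S = "{\<tau> \<in> Sig (k - 1) n. Min ({1..n} - \<tau>) \<in> {l+1..n}}"
  let ?R = "{\<rho>. \<rho> \<subseteq> {l+1..n} \<and> card \<rho> = n - k + 1}"
  have S: "?S = {\<tau> \<in> Sig (k - 1) n. {1..n} - \<tau> \<subseteq> {l+1..n}}"
  proof -
    have "Min ({1..n} - \<tau>) \<in> {l+1..n} \<longleftrightarrow> {1..n} - \<tau> \<subseteq> {l+1..n}" if "\<tau> \<in> Sig (k - 1) n" for \<tau>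
    proof
      assume "Min ({1..n} - \<tau>) \<in> {l+1..n}"
      then show "{1..n} - \<tau> \<subseteq> {l+1..n}"
        using Min_le[OF complement_nonempty(1)[OF that]] by (meson Diff_iff atLeastAtMost_iff order_trans subsetI)
    next
      assume "{1..n} - \<tau> \<subseteq> {l+1..n}"
      then show "Min ({1..n} - \<tau>) \<in> {l+1..n}"
        using Min_in[OF complement_nonempty[OF that]] by blast
    qed
    then show ?thesis
      by blast
  qed
  have "bij_betw (\<lambda>\<tau>. {1..n} - \<tau>) ?S ?R"
  proof (rule bij_betw_byWitness[where f' = "\<lambda>\<rho>. {1..n} - \<rho>"])
    show "\<forall>\<tau>\<in>?S. {1..n} - ({1..n} - \<tau>) = \<tau>"
      by (auto simp: Sig_def)
    show "\<forall>\<rho>\<in>?R. {1..n} - ({1..n} - \<rho>) = \<rho>"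
      by auto
    show "(\<lambda>\<tau>. {1..n} - \<tau>) ` ?S \<subseteq> ?R"
    proof (rule image_subsetI)
      fix \<tau> assume "\<tau> \<in> ?S"
      then have \<tau>: "\<tau> \<in> Sig (k - 1) n" "{1..n} - \<tau> \<subseteq> {l+1..n}"
        unfolding S by auto
      \<comment> \<open>This equals \<open>n - k + 1\<close> in truncated arithmetic because
        \<open>1 \<le> k\<close> and \<open>k \<le> n\<close>.\<close>
      then have "card ({1..n} - \<tau>) = n - (k - 1)"
        using Sig_finite[OF \<tau>(1)] by (simp add: Sig_def card_Diff_subset)
      with \<tau> k show "{1..n} - \<tau> \<in> ?R"
        by auto
    qed
    show "(\<lambda>\<rho>. {1..n} - \<rho>) ` ?R \<subseteq> ?S"
    proof (rule image_subsetI)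
      fix \<rho> assume "\<rho> \<in> ?R"
      then have \<rho>: "\<rho> \<subseteq> {l+1..n}" "card \<rho> = n - k + 1"
        by auto
      then have "\<rho> \<subseteq> {1..n}"
        by auto
      moreover from this have "card ({1..n} - \<rho>) = k - 1"
        using \<rho>(2) k finite_subset[of \<rho> "{1..n}"] by (simp add: card_Diff_subset)
      ultimately show "{1..n} - \<rho> \<in> ?S"
        unfolding S using \<rho>(1) by (auto simp: Sig_def)
    qed
  qed
  then have "card ?S = card ?R"
    by (rule bij_betw_same_card)
  also have "\<dots> = (n - l) choose (n - k + 1)"
    by (subst n_subsets) auto
  finally show ?thesis .
qed

lemma card_free_normal:
  assumes "l \<le> n"
  shows "int (card {x \<in> free_indices n k. snd x \<in> {l+1..n}}) =
    int (n - l) * int (n choose k) - int ((n - l) choose (n - k + 1))"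
  using card_free_indices[of "{l+1..n}"] card_Min_complement[OF assms] by simp

text \<open>Each \<tau> has its minimum of the complement on one side of \<open>l\<close>; the
  tangential ones are counted as all minus the normal ones.\<close>

lemma card_free_tangential:
  assumes "l \<le> n"
  shows "int (card {x \<in> free_indices n k. snd x \<in> {1..l}}) =
    int l * int (n choose k) + int ((n - l) choose (n - k + 1)) - int (n choose (k - 1))"
proof -
  let ?S = "\<lambda>A. {\<tau> \<in> Sig (k - 1) n. Min ({1..n} - \<tau>) \<in> A}"
  have "?S {1..l} \<union> ?S {l+1..n} = Sig (k - 1) n"
    using Min_complement(1) assms by fastforce
  moreover have "card (?S {1..l} \<union> ?S {l+1..n}) = card (?S {1..l}) + card (?S {l+1..n})"
    by (rule card_Un_disjoint) (auto simp: finite_Sig)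
  ultimately have "card (Sig (k - 1) n) = card (?S {1..l}) + card (?S {l+1..n})"
    by simp
  then show ?thesis
    using card_free_indices[of "{1..l}"] card_Min_complement[OF assms] assms by (simp add: card_Sig)
qed

end

end

section \<open>The dual frame of a tangential-normal basis\<close>

lemma tn_basis_dual:
  fixes b :: "nat \<Rightarrow> 'a::euclidean_space"
  assumes tn: "tn_basis n l f b" and n: "DIM('a) = n" and l: "l \<le> n"
  obtains e where "\<And>i j. i \<in> {1..n} \<Longrightarrow> j \<in> {1..n} \<Longrightarrow> b i \<bullet> e j = (if i = j then 1 else 0)"
    and "\<And>x. x = (\<Sum>j=1..n. (b j \<bullet> x) *\<^sub>R e j)"
proof -
  let ?T = "b ` {1..l}" and ?N = "b ` {l+1..n}"
  have tn': "inj_on b {1..l}" "inj_on b {l+1..n}" "independent ?T" "independent ?N"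
    "?T \<subseteq> tangent_space f" "\<And>x y. x \<in> ?N \<Longrightarrow> y \<in> tangent_space f \<Longrightarrow> orthogonal x y"
    using tn by (auto simp: tn_basis_def)
  have un: "{1..n} = {1..l} \<union> {l+1..n}"
    using l by auto
  have spT: "span ?T \<subseteq> tangent_space f"
    using tn'(5) by (intro span_minimal) (auto simp: tangent_space_def)
  \<comment> \<open>Orthogonality of the given vectors passes to their spans, which therefore meet
    only in 0.\<close>
  have orth: "orthogonal x y" if "x \<in> span ?N" "y \<in> span ?T" for x y
  proof -
    have "orthogonal y x"
    proof (rule orthogonal_to_span[OF that(1)])
      fix z assume "z \<in> ?N"
      then show "orthogonal y z"
        using tn'(6)[of z y] spT that(2) orthogonal_commute by blast
    qed
    then show ?thesis
      by (simp add: orthogonal_commute)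
  qed
  have int0: "span ?T \<inter> span ?N = {0}"
  proof -
    have "x = 0" if "x \<in> span ?T" "x \<in> span ?N" for x
      using orth[OF that(2,1)] by (simp add: orthogonal_self)
    then show ?thesis
      by (auto intro: span_zero)
  qed
  \<comment> \<open>A common vector would be 0, which no independent set contains. Hence
    \<open>b\<close> is injective on all of \<open>{1..n}\<close>.\<close>
  have "?T \<inter> ?N = {}"
  proof -
    have "0 \<notin> ?T"
      using tn'(3) dependent_zero by blast
    moreover have "x = 0" if "x \<in> ?T" "x \<in> ?N" for x
      using int0 span_base[OF that(1)] span_base[OF that(2)] by (metis IntI singletonD)
    ultimately show ?thesis
      by (metis disjoint_iff)
  qed
  then have inj: "inj_on b {1..n}"
    unfolding un using tn'(1,2) by (auto simp: inj_on_Un)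
  have card: "card (b ` {1..n}) = DIM('a)"
    using inj n by (simp add: card_image)
  \<comment> \<open>The dimensions add up to \<open>l + (n - l) = n\<close>, so \<open>b\<close>
    spans the whole space.\<close>
  have "dim (span (b ` {1..n})) = dim (span ?T) + dim (span ?N)"
    using dim_sums_Int[OF subspace_span subspace_span, of ?T ?N]
    unfolding un image_Un span_Un int0 by simp
  also have "\<dots> = n"
    using tn' l by (simp add: dim_eq_card_independent card_image)
  finally have span: "span (b ` {1..n}) = UNIV"
    using n by (simp flip: dim_eq_full)
  have ind: "independent (b ` {1..n})"
    using card_eq_dim[of "b ` {1..n}" UNIV] card span by (simp add: dim_UNIV)
  \<comment> \<open>The witness \<open>adjoint g 1\<close> is the Riesz representative of the
    functional \<open>g\<close> that is 1 at \<open>b j\<close> and 0 at the other basis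
    vectors.\<close>
  have "\<exists>e. \<forall>i\<in>{1..n}. b i \<bullet> e = (if i = j then 1 else 0)" if "j \<in> {1..n}" for j
  proof -
    obtain g where g: "linear g" "\<And>x. x \<in> b ` {1..n} \<Longrightarrow> g x = (if x = b j then 1 else 0 :: real)"
      using linear_independent_extend[OF ind, of "\<lambda>x. if x = b j then 1 else 0"] by blast
    have "b i \<bullet> adjoint g 1 = g (b i)" for i
      using adjoint_works[OF g(1), of "b i" 1] by simp
    then have "\<forall>i\<in>{1..n}. b i \<bullet> adjoint g 1 = (if i = j then 1 else 0)"
      using g(2) that by (simp add: inj_on_eq_iff[OF inj])
    then show ?thesis ..
  qed
  then obtain e where e: "\<And>i j. i \<in> {1..n} \<Longrightarrow> j \<in> {1..n} \<Longrightarrow> b i \<bullet> e j = (if i = j then 1 else 0)"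
    by metis
  have "x = (\<Sum>j=1..n. (b j \<bullet> x) *\<^sub>R e j)" for x
  proof -
    \<comment> \<open>The defect is orthogonal to every \<open>b i\<close>; as these span the space,
      it is orthogonal to itself.\<close>
    let ?d = "x - (\<Sum>j=1..n. (b j \<bullet> x) *\<^sub>R e j)"
    have "orthogonal ?d (b i)" if "i \<in> {1..n}" for i
      using that e by (simp add: orthogonal_def inner_commute[of _ "b i"] inner_diff_right inner_sum_right
        if_distrib[of "\<lambda>t. _ * t"] cong: if_cong)
    then have "orthogonal ?d v" if "v \<in> b ` {1..n}" for v
      using that by blast
    then have "orthogonal ?d ?d"
    proof (rule orthogonal_to_span[rotated])
      show "?d \<in> span (b ` {1..n})"
        unfolding span by (rule UNIV_I)
    qed
    then have "?d = 0"
      unfolding orthogonal_self .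
    then show ?thesis
      by (rule eq_iff_diff_eq_0[THEN iffD2])
  qed
  with e show thesis
    by (intro that)
qed

section \<open>The direct sum decomposition and the two dimensions\<close>

theorem lemma6p1:
  fixes T f :: "(real ^ 'n) set" and b :: "nat \<Rightarrow> real ^ 'n" and n k l :: nat
  assumes "CARD('n) = n" and "2 \<le> n" and "1 \<le> k" and "k \<le> n - 1"
    and "int n simplex T"
    and "l \<le> n" and "int l simplex f" and "f face_of T"
    and "tn_basis n l f b"
  shows "XX n k = {x + y |x y. x \<in> T_XX n k l b \<and> y \<in> N_XX n k l b}
    \<and> T_XX n k l b \<inter> N_XX n k l b = {0}
    \<and> int (dim (T_XX n k l b)) =
        int l * int (n choose k) + int ((n - l) choose (n - k + 1)) - int (n choose (k - 1))
    \<and> int (dim (N_XX n k l b)) =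
        int (n - l) * int (n choose k) - int ((n - l) choose (n - k + 1))"
proof -
  have "DIM(real ^ 'n) = n"
    using assms(1) by simp
  then obtain e where e: "\<And>i j. i \<in> {1..n} \<Longrightarrow> j \<in> {1..n} \<Longrightarrow> b i \<bullet> e j = (if i = j then 1 else 0)"
    "\<And>x. x = (\<Sum>j=1..n. (b j \<bullet> x) *\<^sub>R e j)"
    using tn_basis_dual[OF assms(9) _ assms(6)] by blast
  interpret coframe n k "dual_form b" e
    using assms e by unfold_locales (auto simp: dual_form_def inner_add_right intro!: linearI)
  let ?F = "\<lambda>A. {x \<in> free_indices n k. snd x \<in> A}"
  \<comment> \<open>Taking \<open>A\<close> as the tangential or the normal range turns
    \<open>T_XX\<close> and \<open>N_XX\<close> into spans of prescribed projection values, to which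
    the coordinate arguments apply.\<close>
  have span: "span {proj_XX n k (dual_form b) (basis_elt n (dual_form b) (\<sigma>, i)) |\<sigma> i.
     (\<sigma>, i) \<in> free_indices n k \<and> i \<in> A} = span (proj_value n (dual_form b) ` ?F A)" for A
  proof -
    have "proj_XX n k (dual_form b) (basis_elt n (dual_form b) x) = proj_value n (dual_form b) x"
      if "x \<in> free_indices n k" for x
      using that by (intro proj_XX_basis) (simp add: free_indices_def)
    then have "proj_value n (dual_form b) ` ?F A =
      (\<lambda>x. proj_XX n k (dual_form b) (basis_elt n (dual_form b) x)) ` ?F A"
      by (intro image_cong) auto
    also have "\<dots> = {proj_XX n k (dual_form b) (basis_elt n (dual_form b) (\<sigma>, i)) |\<sigma> i.
      (\<sigma>, i) \<in> free_indices n k \<and> i \<in> A}"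
    proof -
      have "h ` ?F A = {h (\<sigma>, i) |\<sigma> i. (\<sigma>, i) \<in> free_indices n k \<and> i \<in> A}"
        for h :: "nat set \<times> nat \<Rightarrow> 'd"
        by (auto simp: image_iff) blast
      then show ?thesis .
    qed
    finally show ?thesis
      by simp
  qed
  note T = span[of "{1..l}", folded T_XX_def] and N = span[of "{l+1..n}", folded N_XX_def]
  have un: "?F {1..l} \<union> ?F {l+1..n} = free_indices n k"
    using assms(6) by (auto simp: free_indices_def all_indices_def)
  \<comment> \<open>A sum of spans is the span of the union, and the two ranges together exhaust the
    free indices.\<close>
  have "XX n k = {x + y |x y. x \<in> T_XX n k l b \<and> y \<in> N_XX n k l b}"
    unfolding T N span_Un[symmetric] image_Un[symmetric] un XX_eq_span ..
  moreover have "T_XX n k l b \<inter> N_XX n k l b = {0}"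
    unfolding T N by (intro span_proj_value_disjoint un) auto
  moreover have "dim (T_XX n k l b) = card (?F {1..l})" "dim (N_XX n k l b) = card (?F {l+1..n})"
    unfolding T N by (intro dim_span_proj_value; blast)+
  ultimately show ?thesis
    using card_free_tangential[OF assms(6)] card_free_normal[OF assms(6)] by simp
qed

end
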